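(* Let $\Lambda\ge2$ be an integer and $\rho\in[0,1)$, and let the processor availability model have all transition probabilities equal, $q_{ij}=1/(\Lambda+1)$ for all $i,j\in\{0,\dots,\Lambda\}$. With $\Omega$, $\Upsilon_\varsigma$ and $\bar f_\Lambda(\rho)$ as defined in the context, suppose $$\bar f_\Lambda(\rho)\,(\Lambda+1-\Lambda\rho)<\Lambda+1 .$$ Then, for $\alpha$ in the range $0\le\alpha<\Lambda+1$ (equivalently $\alpha q_{00}<1$), the sufficient stability condition "$\Upsilon_\varsigma<1$ for all $\varsigma\in\{2,\dots,\Lambda+1\}$" is more conservative than the sufficient stability condition "$\Omega<1$"; that is, every $\alpha\in[0,\Lambda+1)$ with $\Upsilon_\varsigma<1$ for all $\varsigma\in\{2,\dots,\Lambda+1\}$ satisfies $\Omega<1$, and there exist $\alpha\in[0,\Lambda+1)$ with $\Omega<1$ for which $\Upsilon_\varsigma<1$ fails for some $\varsigma\in\{2,\dots,\Lambda+1\}$.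
   Context: Convention: $0^0=1$. $\{N(k)\}_{k\ge0}$ is the homogeneous Markov chain on $\{0,\dots,\Lambda\}$ with $N(0)=0$ and transition probabilities $q_{ij}=\mathbf{Pr}\{N(k+1)=j\mid N(k)=i\}$ (here all equal to $1/(\Lambda+1)$). The effective buffer length is given by $\lambda(-1)=0$, $\lambda(k)=N(k)$ if $N(k)\ge1$, and $\lambda(k)=\max(\lambda(k-1)-1,0)$ if $N(k)=0$. Let $k_0=0$, $k_{i+1}=\inf\{k\in\mathbb{N}:k>k_i,\ \lambda(k)=0\}$ and $\Delta_i=k_{i+1}-k_i$; the $\Delta_i$ are i.i.d. $$\Omega=\alpha\sum_{j\ge1}\mathbf{Pr}\{\Delta_i=j\}\rho^{j-1},\qquad \bar f_\Lambda(\rho)=(\Lambda+1)\sum_{j\ge1}\mathbf{Pr}\{\Delta_i=j\}\rho^{j-1},$$ so that $\Omega=\frac{\alpha}{\Lambda+1}\bar f_\Lambda(\rho)$. For $\varsigma\in\{2,\dots,\Lambda+1\}$, $$\Upsilon_\varsigma=\frac{q_{(\varsigma-1)0}(1-q_{00})}{1-q_{00}\rho}\left(\frac{\alpha-\rho}{1-q_{00}\alpha}\,q_{00}^{\varsigma-2}\rho^{\varsigma-1}+\rho^2\right)+\rho\,(1-q_{(\varsigma-1)0}).$$ The condition "$\alpha q_{00}<1$ and $\Upsilon_\varsigma<1$ for all $\varsigma$" is the specialization to this model of the sufficient stability condition from an earlier work, to which the condition $\Omega<1$ is compared. Here $\rho$ is the closed-loop contraction factor and $\alpha\ge0$ the open-loop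 growth bound of a Lyapunov function. *)

theory Defs
  imports "HOL-Probability.Probability"
begin

text \<open>Homogeneous Markov chain with state space \<open>S\<close> and transition probabilities \<open>q\<close>.  The Markov
  property is only required along pasts of positive probability, since \<open>cond_prob\<close> is 0 by
  convention when conditioning on a null event.\<close>

definition homogeneous_markov_chain ::
  "'a measure \<Rightarrow> nat set \<Rightarrow> (nat \<Rightarrow> nat \<Rightarrow> real) \<Rightarrow> (nat \<Rightarrow> 'a \<Rightarrow> nat) \<Rightarrow> bool" where
  "homogeneous_markov_chain M S q N \<longleftrightarrow>
     prob_space M \<and>
     (\<forall>k. N k \<in> measurable M (count_space S)) \<and>
     (\<forall>k x. (\<forall>l\<le>k + 1. x l \<in> S) \<longrightarrow> \<P>(\<omega> in M. \<forall>l\<le>k. N l \<omega> = x l) > 0 \<longrightarrow>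
        \<P>(\<omega> in M. N (k + 1) \<omega> = x (k + 1) \<bar> \<forall>l\<le>k. N l \<omega> = x l) = q (x k) (x (k + 1)))"

text \<open>Effective buffer length \<open>\<lambda>(k)\<close> along a path \<open>n\<close> of the availability process.  Truncated
  subtraction on \<^typ>\<open>nat\<close> renders \<open>max (\<lambda>(k-1) - 1) 0\<close>; the first argument 0 at time 0 is
  \<open>\<lambda>(-1) = 0\<close>.\<close>

definition buffer_step :: "nat \<Rightarrow> nat \<Rightarrow> nat" where
  "buffer_step prev m = (if m \<ge> 1 then m else prev - 1)"

primrec buffer_length :: "(nat \<Rightarrow> nat) \<Rightarrow> nat \<Rightarrow> nat" where
  "buffer_length n 0 = buffer_step 0 (n 0)"
| "buffer_length n (Suc k) = buffer_step (buffer_length n k) (n (Suc k))"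

text \<open>The instants \<open>k\<^sub>i\<close> at which the buffer is empty.  They are extended naturals:
  \<open>Inf {} = \<infinity>\<close>, and \<open>\<infinity> - \<infinity> = \<infinity>\<close>, so a gap is finite only if both its endpoints exist.\<close>

primrec empty_time :: "(nat \<Rightarrow> nat) \<Rightarrow> nat \<Rightarrow> enat" where
  "empty_time n 0 = 0"
| "empty_time n (Suc i) = Inf {enat k | k. enat k > empty_time n i \<and> buffer_length n k = 0}"

definition \<Delta> :: "(nat \<Rightarrow> 'a \<Rightarrow> nat) \<Rightarrow> nat \<Rightarrow> 'a \<Rightarrow> enat" where
  "\<Delta> N i \<omega> = empty_time (\<lambda>k. N k \<omega>) (Suc i) - empty_time (\<lambda>k. N k \<omega>) i"

definition \<Omega> :: "'a measure \<Rightarrow> (nat \<Rightarrow> 'a \<Rightarrow> nat) \<Rightarrow> nat \<Rightarrow> real \<Rightarrow> real \<Rightarrow> real" where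
  "\<Omega> M N i \<alpha> \<rho> = \<alpha> * (\<Sum>\<^sub>\<infinity>j\<in>{1..}. \<P>(\<omega> in M. \<Delta> N i \<omega> = enat j) * \<rho> ^ (j - 1))"

definition f_bar :: "'a measure \<Rightarrow> (nat \<Rightarrow> 'a \<Rightarrow> nat) \<Rightarrow> nat \<Rightarrow> nat \<Rightarrow> real \<Rightarrow> real" where
  "f_bar M N i \<Lambda> \<rho> =
     (real \<Lambda> + 1) * (\<Sum>\<^sub>\<infinity>j\<in>{1..}. \<P>(\<omega> in M. \<Delta> N i \<omega> = enat j) * \<rho> ^ (j - 1))"

definition \<Upsilon> :: "(nat \<Rightarrow> nat \<Rightarrow> real) \<Rightarrow> real \<Rightarrow> real \<Rightarrow> nat \<Rightarrow> real" where
  "\<Upsilon> q \<alpha> \<rho> s =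
     q (s - 1) 0 * (1 - q 0 0) / (1 - q 0 0 * \<rho>) *
       ((\<alpha> - \<rho>) / (1 - q 0 0 * \<alpha>) * q 0 0 ^ (s - 2) * \<rho> ^ (s - 1) + \<rho>\<^sup>2)
     + \<rho> * (1 - q (s - 1) 0)"

end

theory Submission
  imports Defs
begin

text \<open>For the uniform chain the stability condition at \<open>\<varsigma> = 2\<close> collapses: \<open>\<Upsilon>\<^sub>2 = \<Lambda>\<rho> / (\<Lambda> + 1 - \<alpha>)\<close>
  (lemma \<open>\<Upsilon>_2_uniform\<close>), so it says exactly \<open>\<alpha> < \<alpha>\<^sup>*\<close> with \<open>\<alpha>\<^sup>* = \<Lambda> + 1 - \<Lambda>\<rho>\<close>.  On the other side
  \<open>\<Omega> = \<alpha> f / (\<Lambda> + 1)\<close> is nondecreasing in \<open>\<alpha>\<close>, where \<open>f\<close> is the value of \<open>f_bar\<close> at \<open>\<rho>\<close>, and the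
  hypothesis \<open>f \<cdot> \<alpha>\<^sup>* < \<Lambda> + 1\<close> states precisely that \<open>\<Omega> < 1\<close> still holds at \<open>\<alpha> = \<alpha>\<^sup>*\<close>.  This gives the
  implication for all \<open>\<alpha> < \<alpha>\<^sup>*\<close>, and \<open>\<alpha>\<^sup>*\<close> itself separates the two conditions, because
  \<open>\<Upsilon>\<^sub>2 = 1\<close> there.

  The witness \<open>\<alpha>\<^sup>*\<close> lies below \<open>\<Lambda> + 1\<close> only if \<open>\<rho> > 0\<close>.  The case \<open>\<rho> = 0\<close> has to be excluded through
  the hypothesis, and this is where probability enters: at \<open>\<rho> = 0\<close> only gaps of length one
  contribute to \<open>f\<close>, and such a gap has probability \<open>1 / (\<Lambda> + 1)\<close> (lemma \<open>prob_gap_eq_1\<close>), so that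
  \<open>f = 1\<close> and the hypothesis would read \<open>\<Lambda> + 1 < \<Lambda> + 1\<close>.  At an instant \<open>k\<^sub>i\<close> the buffer is empty,
  hence the gap is one exactly if the next value of the chain is 0.  Whether \<open>k\<^sub>i = k\<close> is decided by
  the chain up to time \<open>k\<close>, and the step to 0 has the same probability from every state, so it is
  independent of that past; summing over \<open>k\<close> gives the claim once \<open>k\<^sub>i\<close> is known to be almost surely
  finite (lemma \<open>AE_buffer_empties_again\<close>).\<close>

section \<open>Events determined by the past of the chain\<close>

definition determined_by :: "nat \<Rightarrow> ((nat \<Rightarrow> nat) \<Rightarrow> bool) \<Rightarrow> bool" where
  "determined_by k A \<longleftrightarrow> (\<forall>n n'. (\<forall>l\<le>k. n l = n' l) \<longrightarrow> A n = A n')"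

lemma determined_byD: "determined_by k A \<Longrightarrow> (\<And>l. l \<le> k \<Longrightarrow> n l = n' l) \<Longrightarrow> A n = A n'"
  unfolding determined_by_def by blast

lemma determined_byI:
  "(\<And>n n'. (\<And>l. l \<le> k \<Longrightarrow> n l = n' l) \<Longrightarrow> A n = A n') \<Longrightarrow> determined_by k A"
  unfolding determined_by_def by blast

lemma chain_measurable:
  "homogeneous_markov_chain M S q N \<Longrightarrow> N k \<in> measurable M (count_space S)"
  unfolding homogeneous_markov_chain_def by blast

lemma chain_prob_space: "homogeneous_markov_chain M S q N \<Longrightarrow> prob_space M"
  unfolding homogeneous_markov_chain_def by blast

lemma chain_in_states:
  assumes "homogeneous_markov_chain M S q N" and "\<omega> \<in> space M"
  shows "N k \<omega> \<in> S"
  using measurable_space[OF chain_measurable[OF assms(1), of k] assms(2)] by simp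

lemma chain_cylinder_measurable:
  assumes "homogeneous_markov_chain M S q N" and "\<And>l. l \<le> k \<Longrightarrow> x l \<in> S"
  shows "{\<omega>\<in>space M. \<forall>l\<le>(k::nat). N l \<omega> = x l} \<in> sets M"
proof -
  have "{\<omega>\<in>space M. \<forall>l\<le>k. N l \<omega> = x l} = (\<Inter>l\<in>{..k}. N l -` {x l} \<inter> space M)"
    by auto
  also have "\<dots> \<in> sets M"
    using assms(2)
    by (intro sets.finite_INT measurable_sets[OF chain_measurable[OF assms(1)]]) auto
  finally show ?thesis .
qed

text \<open>The remainder condition \<open>R\<close> is carried along so that one decomposition serves both for the
  past event alone and for the past event joined with the next step.\<close>

lemma past_event_decomposition:
  assumes chain: "homogeneous_markov_chain M S q N" and det: "determined_by k A"
  shows "{\<omega>\<in>space M. A (\<lambda>l. N l \<omega>) \<and> R \<omega>} =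
    (\<Union>x\<in>{x \<in> {..k} \<rightarrow>\<^sub>E S. A x}. {\<omega>\<in>space M. (\<forall>l\<le>k. N l \<omega> = x l) \<and> R \<omega>})"
proof (intro set_eqI iffI)
  fix \<omega> assume w: "\<omega> \<in> {\<omega>\<in>space M. A (\<lambda>l. N l \<omega>) \<and> R \<omega>}"
  have S: "N l \<omega> \<in> S" for l
    using chain_in_states[OF chain] w by auto
  define x where "x = restrict (\<lambda>l. N l \<omega>) {..k}"
  have "A x = A (\<lambda>l. N l \<omega>)"
    by (rule determined_byD[OF det]) (auto simp: x_def)
  then have "x \<in> {x \<in> {..k} \<rightarrow>\<^sub>E S. A x}"
    using S w by (auto simp: x_def)
  moreover have "\<forall>l\<le>k. N l \<omega> = x l"
    by (auto simp: x_def)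
  ultimately show "\<omega> \<in> (\<Union>x\<in>{x \<in> {..k} \<rightarrow>\<^sub>E S. A x}.
      {\<omega>\<in>space M. (\<forall>l\<le>k. N l \<omega> = x l) \<and> R \<omega>})"
    using w by blast
next
  fix \<omega> assume "\<omega> \<in> (\<Union>x\<in>{x \<in> {..k} \<rightarrow>\<^sub>E S. A x}.
      {\<omega>\<in>space M. (\<forall>l\<le>k. N l \<omega> = x l) \<and> R \<omega>})"
  then obtain x where x: "A x" "\<omega> \<in> space M" "\<forall>l\<le>k. N l \<omega> = x l" "R \<omega>"
    by auto
  moreover have "A (\<lambda>l. N l \<omega>) = A x"
    by (rule determined_byD[OF det]) (use x in auto)
  ultimately show "\<omega> \<in> {\<omega>\<in>space M. A (\<lambda>l. N l \<omega>) \<and> R \<omega>}"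
    by auto
qed

lemma past_event_measurable:
  assumes chain: "homogeneous_markov_chain M S q N" and fin: "finite S"
    and det: "determined_by k A"
  shows "{\<omega>\<in>space M. A (\<lambda>l. N l \<omega>)} \<in> sets M"
proof -
  have "(\<Union>x\<in>{x \<in> {..k} \<rightarrow>\<^sub>E S. A x}. {\<omega>\<in>space M. \<forall>l\<le>k. N l \<omega> = x l}) \<in> sets M"
    using fin by (intro sets.finite_UN finite_subset[OF _ finite_PiE[of "{..k}" "\<lambda>_. S"]]
        chain_cylinder_measurable[OF chain]) auto
  then show ?thesis
    using past_event_decomposition[OF chain det, of "\<lambda>_. True"] by simp
qed

text \<open>The Markov property speaks of single past trajectories.  Since the state space is finite, a past
  event is a finite disjoint union of trajectories, and the common factor \<open>r\<close> comes out of the sum.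
  Trajectories of probability zero, about which the Markov property says nothing, contribute zero to
  both sides.\<close>

lemma prob_past_event_and_step:
  assumes chain: "homogeneous_markov_chain M S q N" and fin: "finite S"
    and b: "b \<in> S" and r: "\<And>a. a \<in> S \<Longrightarrow> q a b = r"
    and det: "determined_by k A"
  shows "\<P>(\<omega> in M. A (\<lambda>l. N l \<omega>) \<and> N (Suc k) \<omega> = b) = r * \<P>(\<omega> in M. A (\<lambda>l. N l \<omega>))"
proof -
  interpret prob_space M
    using chain by (rule chain_prob_space)
  define F where "F = {x \<in> {..k} \<rightarrow>\<^sub>E S. A x}"
  define C where "C x = {\<omega>\<in>space M. \<forall>l\<le>k. N l \<omega> = x l}" for x
  define D where "D x = {\<omega>\<in>space M. (\<forall>l\<le>k. N l \<omega> = x l) \<and> N (Suc k) \<omega> = b}" for x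
  have finF: "finite F"
    using fin unfolding F_def
    by (intro finite_subset[OF _ finite_PiE[of "{..k}" "\<lambda>_. S"]]) auto
  have disj: "disjoint_family_on C F" "disjoint_family_on D F"
    unfolding disjoint_family_on_def F_def C_def D_def
    by (auto; metis PiE_ext atMost_iff)+
  have xS: "x l \<in> S" if "x \<in> F" "l \<le> k" for x l
    using that by (auto simp: F_def)
  have C: "C x \<in> sets M" if "x \<in> F" for x
    unfolding C_def using xS[OF that] by (rule chain_cylinder_measurable[OF chain])
  have Nb: "N (Suc k) -` {b} \<inter> space M \<in> sets M"
    using b by (intro measurable_sets[OF chain_measurable[OF chain]]) auto
  have D_eq: "D x = C x \<inter> (N (Suc k) -` {b} \<inter> space M)" for x
    by (auto simp: C_def D_def)
  have D: "D x \<in> sets M" if "x \<in> F" for x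
    unfolding D_eq using C[OF that] Nb by auto
  have step: "prob (D x) = r * prob (C x)" if x: "x \<in> F" for x
  proof (cases "prob (C x) > 0")
    case True
    \<comment> \<open>\<open>x\<close> is a function on \<open>{..k}\<close> extended by a default value; its value at \<open>Suc k\<close> is free to be set.\<close>
    let ?y = "x(Suc k := b)"
    have C': "{\<omega>\<in>space M. \<forall>l\<le>k. N l \<omega> = ?y l} = C x"
      by (auto simp: C_def)
    have "\<forall>l\<le>k + 1. ?y l \<in> S"
      using xS[OF x] b by (auto simp: le_Suc_eq)
    moreover have "\<P>(\<omega> in M. \<forall>l\<le>k. N l \<omega> = ?y l) > 0"
      using True unfolding C' .
    ultimately have
      "\<P>(\<omega> in M. N (k + 1) \<omega> = ?y (k + 1) \<bar> \<forall>l\<le>k. N l \<omega> = ?y l) = q (?y k) (?y (k + 1))"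
      using chain unfolding homogeneous_markov_chain_def by blast
    then have "prob {\<omega>\<in>space M. N (Suc k) \<omega> = b \<and> (\<forall>l\<le>k. N l \<omega> = ?y l)} / prob (C x) = r"
      using r[OF xS[OF x, of k]] by (simp only: cond_prob_def C') simp
    moreover have "{\<omega>\<in>space M. N (Suc k) \<omega> = b \<and> (\<forall>l\<le>k. N l \<omega> = ?y l)} = D x"
      by (auto simp: D_def)
    ultimately show ?thesis
      using True by (simp add: field_simps)
  next
    case False
    then have "prob (C x) = 0"
      using measure_nonneg[of M "C x"] by linarith
    moreover have "prob (D x) \<le> prob (C x)"
      using C[OF x] by (intro finite_measure_mono) (auto simp: D_eq)
    ultimately show ?thesis
      using measure_nonneg[of M "D x"] by simp
  qed
  have "\<P>(\<omega> in M. A (\<lambda>l. N l \<omega>) \<and> N (Suc k) \<omega> = b) = prob (\<Union>x\<in>F. D x)"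
    using past_event_decomposition[OF chain det, of "\<lambda>\<omega>. N (Suc k) \<omega> = b"]
    by (simp add: F_def D_def)
  also have "\<dots> = (\<Sum>x\<in>F. prob (D x))"
    using D disj finF by (intro finite_measure_finite_Union) auto
  also have "\<dots> = r * (\<Sum>x\<in>F. prob (C x))"
    by (simp add: step sum_distrib_left)
  also have "(\<Sum>x\<in>F. prob (C x)) = prob (\<Union>x\<in>F. C x)"
    using C disj finF by (intro finite_measure_finite_Union[symmetric]) auto
  also have "\<dots> = \<P>(\<omega> in M. A (\<lambda>l. N l \<omega>))"
    using past_event_decomposition[OF chain det, of "\<lambda>_. True"]
    by (simp add: F_def C_def)
  finally show ?thesis .
qed

lemma prob_past_event_and_run:
  assumes chain: "homogeneous_markov_chain M S q N" and fin: "finite S"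
    and b: "b \<in> S" and r: "\<And>a. a \<in> S \<Longrightarrow> q a b = r"
    and det: "determined_by k A"
  shows "\<P>(\<omega> in M. A (\<lambda>l. N l \<omega>) \<and> (\<forall>l. k < l \<and> l \<le> k + m \<longrightarrow> N l \<omega> = b)) =
    r ^ m * \<P>(\<omega> in M. A (\<lambda>l. N l \<omega>))"
proof (induction m)
  case (Suc m)
  let ?B = "\<lambda>n. A n \<and> (\<forall>l. k < l \<and> l \<le> k + m \<longrightarrow> n l = b)"
  have "determined_by (k + m) ?B"
  proof (rule determined_byI)
    fix n n' :: "nat \<Rightarrow> nat" assume eq: "\<And>l. l \<le> k + m \<Longrightarrow> n l = n' l"
    have "A n = A n'"
      by (rule determined_byD[OF det]) (simp add: eq)
    then show "?B n = ?B n'"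
      using eq by auto
  qed
  from prob_past_event_and_step[OF chain fin b r this]
  have "\<P>(\<omega> in M. ?B (\<lambda>l. N l \<omega>) \<and> N (Suc (k + m)) \<omega> = b) =
      r * \<P>(\<omega> in M. ?B (\<lambda>l. N l \<omega>))" .
  moreover have "{\<omega>\<in>space M. ?B (\<lambda>l. N l \<omega>) \<and> N (Suc (k + m)) \<omega> = b} =
      {\<omega>\<in>space M. A (\<lambda>l. N l \<omega>) \<and> (\<forall>l. k < l \<and> l \<le> k + Suc m \<longrightarrow> N l \<omega> = b)}"
    by (auto simp: le_Suc_eq)
  ultimately show ?case
    unfolding Suc.IH power_Suc mult.assoc by (simp only:)
next
  case 0
  have "{\<omega>\<in>space M. A (\<lambda>l. N l \<omega>) \<and> (\<forall>l. k < l \<and> l \<le> k + 0 \<longrightarrow> N l \<omega> = b)} =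
      {\<omega>\<in>space M. A (\<lambda>l. N l \<omega>)}"
    by auto
  then show ?case
    by (simp only: power_0 mult_1)
qed

section \<open>Buffer length and empty times along a path\<close>

lemma buffer_length_cong:
  "(\<And>l. l \<le> k \<Longrightarrow> n l = n' l) \<Longrightarrow> buffer_length n k = buffer_length n' k"
proof (induction k)
  case (Suc k)
  then have "buffer_length n k = buffer_length n' k" and "n (Suc k) = n' (Suc k)"
    by auto
  then show ?case
    by simp
qed simp

lemma buffer_length_le: "(\<And>l. n l \<le> L) \<Longrightarrow> buffer_length n k \<le> L"
proof (induction k)
  case (Suc k)
  then have "buffer_length n k \<le> L" and "n (Suc k) \<le> L"
    by blast+
  then show ?case
    by (auto simp: buffer_step_def)
qed (simp add: buffer_step_def)

text \<open>In particular \<open>L\<close> consecutive zeros empty a buffer of length at most \<open>L\<close>.\<close>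

lemma buffer_length_zero_run:
  "(\<And>l. k < l \<Longrightarrow> l \<le> k + m \<Longrightarrow> n l = 0) \<Longrightarrow> buffer_length n (k + m) = buffer_length n k - m"
proof (induction m)
  case (Suc m)
  have "buffer_length n (k + m) = buffer_length n k - m"
    by (rule Suc.IH) (use Suc.prems in auto)
  moreover have "n (Suc (k + m)) = 0"
    by (rule Suc.prems) auto
  ultimately show ?case
    by (simp add: buffer_step_def)
qed simp

text \<open>For finite values the infimum becomes a statement about finitely many instants up to \<open>k\<close>; this is
  what makes \<open>k\<^sub>i\<close> a stopping time.\<close>

lemma empty_time_Suc_eq_enat_iff:
  "empty_time n (Suc i) = enat k \<longleftrightarrow>
    (\<exists>j<k. empty_time n i = enat j \<and> buffer_length n k = 0 \<and>
       (\<forall>l. j < l \<and> l < k \<longrightarrow> buffer_length n l \<noteq> 0))"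
proof -
  let ?X = "{enat k | k. enat k > empty_time n i \<and> buffer_length n k = 0}"
  have T: "empty_time n (Suc i) = Inf ?X"
    by simp
  show ?thesis
  proof
    assume eq: "empty_time n (Suc i) = enat k"
    then have "?X \<noteq> {}"
      unfolding T by (auto simp: Inf_enat_def split: if_splits)
    then have "Inf ?X \<in> ?X"
      by (metis (no_types, lifting) wellorder_InfI ex_in_conv)
    then have k: "enat k > empty_time n i" "buffer_length n k = 0"
      using eq unfolding T by auto
    then obtain j where j: "empty_time n i = enat j" "j < k"
      by (cases "empty_time n i") auto
    have "buffer_length n l \<noteq> 0" if "j < l" "l < k" for l
    proof
      assume "buffer_length n l = 0"
      then have "Inf ?X \<le> enat l"
        using that j by (intro Inf_lower) auto
      then show False
        using eq that unfolding T by simp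
    qed
    then show "\<exists>j<k. empty_time n i = enat j \<and> buffer_length n k = 0 \<and>
       (\<forall>l. j < l \<and> l < k \<longrightarrow> buffer_length n l \<noteq> 0)"
      using k j by auto
  next
    assume "\<exists>j<k. empty_time n i = enat j \<and> buffer_length n k = 0 \<and>
       (\<forall>l. j < l \<and> l < k \<longrightarrow> buffer_length n l \<noteq> 0)"
    then obtain j where j: "j < k" "empty_time n i = enat j" "buffer_length n k = 0"
      "\<And>l. j < l \<Longrightarrow> l < k \<Longrightarrow> buffer_length n l \<noteq> 0"
      by auto
    have "Inf ?X = enat k"
    proof (rule antisym)
      show "Inf ?X \<le> enat k"
        using j by (intro Inf_lower) auto
      show "enat k \<le> Inf ?X"
      proof (rule Inf_greatest)
        fix x assume "x \<in> ?X"
        then obtain l where l: "x = enat l" "j < l" "buffer_length n l = 0"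
          using j(2) by auto
        then have "\<not> l < k"
          using j(4) by blast
        then show "enat k \<le> x"
          using l(1) by simp
      qed
    qed
    then show "empty_time n (Suc i) = enat k"
      unfolding T .
  qed
qed

lemma determined_by_empty_time: "determined_by k (\<lambda>n. empty_time n i = enat k)"
proof (induction i arbitrary: k)
  case 0
  show ?case
    by (simp add: determined_by_def)
next
  case (Suc i)
  show ?case
  proof (rule determined_byI)
    fix n n' :: "nat \<Rightarrow> nat" assume eq: "\<And>l. l \<le> k \<Longrightarrow> n l = n' l"
    have E: "(empty_time n i = enat j) = (empty_time n' i = enat j)" if "j < k" for j
      by (rule determined_byD[OF Suc.IH]) (use eq that in auto)
    have L: "buffer_length n l = buffer_length n' l" if "l \<le> k" for l
      by (rule buffer_length_cong) (use eq that in auto)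
    have "(\<forall>l. j < l \<and> l < k \<longrightarrow> buffer_length n l \<noteq> 0) \<longleftrightarrow>
        (\<forall>l. j < l \<and> l < k \<longrightarrow> buffer_length n' l \<noteq> 0)" for j
      using L by (metis less_imp_le)
    then show "(empty_time n (Suc i) = enat k) = (empty_time n' (Suc i) = enat k)"
      unfolding empty_time_Suc_eq_enat_iff L[OF order_refl] using E by blast
  qed
qed

lemma empty_time_finite:
  assumes "\<And>j. \<exists>k>j. buffer_length n k = 0"
  shows "\<exists>k. empty_time n i = enat k"
proof (induction i)
  case 0
  have "empty_time n 0 = enat 0"
    by (simp only: empty_time.simps(1) zero_enat_def)
  then show ?case ..
next
  case (Suc i)
  then obtain j where j: "empty_time n i = enat j" ..
  define k where "k = (LEAST k. j < k \<and> buffer_length n k = 0)"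
  have k: "j < k \<and> buffer_length n k = 0"
    unfolding k_def using assms[of j] by (rule LeastI_ex)
  have min: "\<not> (j < l \<and> buffer_length n l = 0)" if "l < k" for l
    using not_less_Least[OF that[unfolded k_def]] .
  have "empty_time n (Suc i) = enat k"
    unfolding empty_time_Suc_eq_enat_iff
  proof (intro exI[of _ j] conjI allI impI)
    fix l assume "j < l \<and> l < k"
    then show "buffer_length n l \<noteq> 0"
      using min[of l] by auto
  qed (use j k in simp_all)
  then show ?case ..
qed

lemma buffer_empty_at_empty_time:
  assumes "n 0 = 0" and "empty_time n i = enat k"
  shows "buffer_length n k = 0"
proof (cases i)
  case 0
  then show ?thesis
    using assms by (simp add: enat_0_iff buffer_step_def)
next
  case (Suc i')
  then show ?thesis
    using assms(2) unfolding Suc empty_time_Suc_eq_enat_iff by blast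
qed

lemma gap_eq_1_iff:
  "empty_time n (Suc i) - empty_time n i = enat 1 \<longleftrightarrow>
    (\<exists>k. empty_time n i = enat k \<and> empty_time n (Suc i) = enat (Suc k))"
proof
  assume gap: "empty_time n (Suc i) - empty_time n i = enat 1"
  then obtain m where m: "empty_time n (Suc i) = enat m"
    by (cases "empty_time n (Suc i)") auto
  then obtain j where "empty_time n i = enat j"
    unfolding empty_time_Suc_eq_enat_iff by auto
  then show "\<exists>k. empty_time n i = enat k \<and> empty_time n (Suc i) = enat (Suc k)"
    using gap m by (intro exI[of _ j]) auto
qed (auto simp del: empty_time.simps)

lemma gap_eq_1_iff_next_zero:
  assumes "n 0 = 0"
  shows "empty_time n (Suc i) - empty_time n i = enat 1 \<longleftrightarrow>
    (\<exists>k. empty_time n i = enat k \<and> n (Suc k) = 0)"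
proof -
  have "empty_time n (Suc i) = enat (Suc k) \<longleftrightarrow> n (Suc k) = 0"
    if k: "empty_time n i = enat k" for k
    using buffer_empty_at_empty_time[OF assms k] k
    unfolding empty_time_Suc_eq_enat_iff by (auto simp: buffer_step_def)
  then show ?thesis
    unfolding gap_eq_1_iff by blast
qed

section \<open>The probability of a gap of length one\<close>

text \<open>From any instant, a run of \<open>L + 1\<close> zeros, which empties the buffer, occurs next with probability
  \<open>p ^ (L + 1)\<close>, whatever happened before.  Over successive blocks of this length the probability of
  never meeting an empty buffer therefore decays geometrically.\<close>

lemma AE_buffer_empties_again:
  assumes chain: "homogeneous_markov_chain M {0..L} q N"
    and p: "\<And>a. a \<le> L \<Longrightarrow> q a 0 = p" and p_pos: "0 < p" "p \<le> 1"
  shows "AE \<omega> in M. \<forall>j. \<exists>k>j. buffer_length (\<lambda>l. N l \<omega>) k = 0"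
proof -
  interpret prob_space M
    using chain by (rule chain_prob_space)
  have "AE \<omega> in M. \<exists>k>j. buffer_length (\<lambda>l. N l \<omega>) k = 0" for j
  proof -
    define P where "P t n \<longleftrightarrow> (\<forall>k. j < k \<and> k \<le> t \<longrightarrow> buffer_length n k \<noteq> 0)"
      for t and n :: "nat \<Rightarrow> nat"
    define E where "E t = {\<omega>\<in>space M. P t (\<lambda>l. N l \<omega>)}" for t
    have detP: "determined_by t (P t)" for t
    proof (rule determined_byI)
      fix n n' :: "nat \<Rightarrow> nat" assume eq: "\<And>l. l \<le> t \<Longrightarrow> n l = n' l"
      have "buffer_length n k = buffer_length n' k" if "k \<le> t" for k
        by (rule buffer_length_cong) (use eq that in auto)
      then show "P t n = P t n'"
        unfolding P_def by metis
    qed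
    have E_meas: "E t \<in> sets M" for t
      unfolding E_def by (rule past_event_measurable[OF chain _ detP]) simp
    define c where "c = 1 - p ^ Suc L"
    have c: "0 \<le> c" "c < 1"
      using p_pos power_le_one[of p "Suc L"] by (auto simp: c_def simp del: power_Suc)
    have shrink: "prob (E (t + Suc L)) \<le> c * prob (E t)" if "j \<le> t" for t
    proof -
      define R where
        "R = {\<omega>\<in>space M. P t (\<lambda>l. N l \<omega>) \<and> (\<forall>l. t < l \<and> l \<le> t + Suc L \<longrightarrow> N l \<omega> = 0)}"
      have probR: "prob R = p ^ Suc L * prob (E t)"
        unfolding R_def E_def
        by (rule prob_past_event_and_run[OF chain _ _ _ detP]) (use p in auto)
      have "determined_by (t + Suc L) (\<lambda>n. P t n \<and> (\<forall>l. t < l \<and> l \<le> t + Suc L \<longrightarrow> n l = 0))"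
      proof (rule determined_byI)
        fix n n' :: "nat \<Rightarrow> nat" assume eq: "\<And>l. l \<le> t + Suc L \<Longrightarrow> n l = n' l"
        have "P t n = P t n'"
          by (rule determined_byD[OF detP]) (rule eq, simp)
        then show "(P t n \<and> (\<forall>l. t < l \<and> l \<le> t + Suc L \<longrightarrow> n l = 0)) =
            (P t n' \<and> (\<forall>l. t < l \<and> l \<le> t + Suc L \<longrightarrow> n' l = 0))"
          using eq by metis
      qed
      from past_event_measurable[OF chain _ this] have R_meas: "R \<in> sets M"
        unfolding R_def by simp
      have sub: "E (t + Suc L) \<subseteq> E t - R"
      proof
        fix \<omega> assume w: "\<omega> \<in> E (t + Suc L)"
        then have "\<omega> \<in> E t"
          by (auto simp: E_def P_def)
        moreover have "\<omega> \<notin> R"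
        proof
          assume "\<omega> \<in> R"
          then have "buffer_length (\<lambda>l. N l \<omega>) (t + Suc L) = buffer_length (\<lambda>l. N l \<omega>) t - Suc L"
            by (intro buffer_length_zero_run) (auto simp: R_def)
          moreover have "buffer_length (\<lambda>l. N l \<omega>) t \<le> L"
          proof (rule buffer_length_le)
            fix l
            show "N l \<omega> \<le> L"
              using chain_in_states[OF chain, of \<omega> l] w by (auto simp: E_def)
          qed
          ultimately have "buffer_length (\<lambda>l. N l \<omega>) (t + Suc L) = 0"
            by linarith
          moreover have "P (t + Suc L) (\<lambda>l. N l \<omega>)"
            using w unfolding E_def mem_Collect_eq by (rule conjunct2)
          moreover have "j < t + Suc L"
            using that by linarith
          ultimately show False
            unfolding P_def by (metis order_refl)
        qed
        ultimately show "\<omega> \<in> E t - R"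
          by simp
      qed
      have "prob (E (t + Suc L)) \<le> prob (E t - R)"
        by (rule finite_measure_mono[OF sub sets.Diff[OF E_meas R_meas]])
      also have "\<dots> = prob (E t) - prob R"
        by (rule finite_measure_Diff[OF E_meas R_meas]) (auto simp: R_def E_def)
      finally show ?thesis
        unfolding probR c_def by (simp only: left_diff_distrib mult_1)
    qed
    have bound: "prob (E (j + m * Suc L)) \<le> c ^ m" for m
    proof (induction m)
      case (Suc m)
      have eq: "j + Suc m * Suc L = (j + m * Suc L) + Suc L"
        by simp
      have "prob (E (j + Suc m * Suc L)) \<le> c * prob (E (j + m * Suc L))"
        unfolding eq by (rule shrink) simp
      also have "\<dots> \<le> c * c ^ m"
        by (rule mult_left_mono[OF Suc.IH c(1)])
      finally show ?case
        by simp
    qed simp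
    define Z where "Z = (\<Inter>t. E t)"
    have Z_meas: "Z \<in> sets M"
      unfolding Z_def using E_meas by (intro sets.countable_INT) auto
    have le: "prob Z \<le> c ^ m" for m
    proof -
      have "prob Z \<le> prob (E (j + m * Suc L))"
        using E_meas by (intro finite_measure_mono) (auto simp: Z_def)
      with bound[of m] show ?thesis
        by linarith
    qed
    have "(\<lambda>m. c ^ m) \<longlonglongrightarrow> 0"
      by (rule LIMSEQ_power_zero) (use c in simp)
    then have "prob Z \<le> 0"
      by (rule LIMSEQ_le_const) (use le in blast)
    then have "prob Z = 0"
      using measure_nonneg[of M Z] by linarith
    then have "AE \<omega> in M. \<omega> \<notin> Z"
      using Z_meas prob_eq_0 by blast
    then show ?thesis
      using AE_space by eventually_elim (auto simp: Z_def E_def P_def)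
  qed
  then show ?thesis
    by (simp add: AE_all_countable)
qed

text \<open>A strong Markov argument for the stopping time \<open>k\<^sub>i\<close>: with \<open>B k\<close> the event \<open>k\<^sub>i = k\<close> and \<open>C k\<close> its
  intersection with \<open>N (k + 1) = 0\<close>, the events \<open>C k\<close> make up, almost surely, the event that the gap is one.
  The events \<open>G k\<close> describe the same event exactly, without using \<open>N 0 = 0\<close>, and serve to show that it
  is measurable.\<close>

lemma prob_gap_eq_1:
  assumes chain: "homogeneous_markov_chain M {0..L} q N"
    and start: "AE \<omega> in M. N 0 \<omega> = 0"
    and p: "\<And>a. a \<le> L \<Longrightarrow> q a 0 = p" and p_pos: "0 < p" "p \<le> 1"
  shows "\<P>(\<omega> in M. \<Delta> N i \<omega> = enat 1) = p"
proof -
  interpret prob_space M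
    using chain by (rule chain_prob_space)
  define B where "B k = {\<omega>\<in>space M. empty_time (\<lambda>l. N l \<omega>) i = enat k}" for k
  define C where "C k = {\<omega>\<in>space M. empty_time (\<lambda>l. N l \<omega>) i = enat k \<and> N (Suc k) \<omega> = 0}" for k
  define G where "G k = {\<omega>\<in>space M. empty_time (\<lambda>l. N l \<omega>) i = enat k \<and>
      empty_time (\<lambda>l. N l \<omega>) (Suc i) = enat (Suc k)}" for k
  have B: "B k \<in> sets M" for k
    unfolding B_def by (rule past_event_measurable[OF chain _ determined_by_empty_time]) simp
  have zero: "{\<omega>\<in>space M. N k \<omega> = 0} \<in> sets M" for k
  proof -
    have "determined_by k (\<lambda>n. n k = 0)"
      by (rule determined_byI) simp
    from past_event_measurable[OF chain _ this] show ?thesis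
      by simp
  qed
  have C_eq: "C k = B k \<inter> {\<omega>\<in>space M. N (Suc k) \<omega> = 0}" for k
    by (auto simp: B_def C_def)
  have C: "C k \<in> sets M" for k
    unfolding C_eq using B zero by auto
  have G: "G k \<in> sets M" for k
  proof -
    have "G k = B k \<inter> {\<omega>\<in>space M. empty_time (\<lambda>l. N l \<omega>) (Suc i) = enat (Suc k)}"
      by (auto simp: B_def G_def)
    moreover have "{\<omega>\<in>space M. empty_time (\<lambda>l. N l \<omega>) (Suc i) = enat (Suc k)} \<in> sets M"
      by (rule past_event_measurable[OF chain _ determined_by_empty_time]) simp
    ultimately show ?thesis
      using B by auto
  qed
  have disj: "disjoint_family B" "disjoint_family C"
    by (auto simp: disjoint_family_on_def B_def C_def)
  have C_B: "prob (C k) = p * prob (B k)" for k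
    unfolding B_def C_def
    by (rule prob_past_event_and_step[OF chain _ _ _ determined_by_empty_time]) (use p in auto)
  have "AE \<omega> in M. \<forall>j. \<exists>k>j. buffer_length (\<lambda>l. N l \<omega>) k = 0"
    by (rule AE_buffer_empties_again[OF chain _ p_pos]) (rule p)
  then have "AE \<omega> in M. \<omega> \<in> (\<Union>k. B k)"
    using AE_space
  proof eventually_elim
    case (elim \<omega>)
    then show ?case
      using empty_time_finite[of "\<lambda>l. N l \<omega>" i] by (auto simp: B_def)
  qed
  then have "prob (\<Union>k. B k) = 1"
    using B by (intro prob_eq_1[THEN iffD2]) auto
  then have "(\<lambda>k. prob (B k)) sums 1"
    using finite_measure_UNION[OF _ disj(1)] B by auto
  then have "(\<lambda>k. prob (C k)) sums p"
    unfolding C_B using sums_mult[of "\<lambda>k. prob (B k)" 1 p] by simp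
  moreover have "(\<lambda>k. prob (C k)) sums prob (\<Union>k. C k)"
    using finite_measure_UNION[OF _ disj(2)] C by auto
  ultimately have C_p: "prob (\<Union>k. C k) = p"
    by (rule sums_unique2[symmetric])
  have gap: "{\<omega>\<in>space M. \<Delta> N i \<omega> = enat 1} = (\<Union>k. G k)"
    unfolding \<Delta>_def gap_eq_1_iff by (auto simp: G_def)
  have "prob {\<omega>\<in>space M. \<Delta> N i \<omega> = enat 1} = prob (\<Union>k. C k)"
  proof (rule finite_measure_eq_AE)
    show "AE \<omega> in M. \<omega> \<in> {\<omega>\<in>space M. \<Delta> N i \<omega> = enat 1} \<longleftrightarrow> \<omega> \<in> (\<Union>k. C k)"
      using start AE_space
    proof eventually_elim
      case (elim \<omega>)
      then show ?case
        using gap_eq_1_iff_next_zero[of "\<lambda>l. N l \<omega>" i] unfolding \<Delta>_def by (auto simp: C_def)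
    qed
  qed (use G C gap in auto)
  with C_p show ?thesis
    by simp
qed

lemma f_bar_0:
  "f_bar M N i L 0 = (real L + 1) * \<P>(\<omega> in M. \<Delta> N i \<omega> = enat 1)"
proof -
  have "(\<Sum>\<^sub>\<infinity>j\<in>{1..}. \<P>(\<omega> in M. \<Delta> N i \<omega> = enat j) * (0::real) ^ (j - 1)) =
      (\<Sum>\<^sub>\<infinity>j\<in>{1}. \<P>(\<omega> in M. \<Delta> N i \<omega> = enat j) * 0 ^ (j - 1))"
    by (rule infsum_cong_neutral) auto
  then show ?thesis
    by (simp add: f_bar_def)
qed

section \<open>Comparison of the two stability conditions\<close>

text \<open>The factor \<open>L + 1 - \<rho>\<close> of the denominator cancels, as
  \<open>(\<alpha> - \<rho>) (L + 1) + \<rho> (L + 1 - \<alpha>) = \<alpha> (L + 1 - \<rho>)\<close>.\<close>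

lemma \<Upsilon>_2_uniform:
  assumes q: "q 0 0 = 1 / (L + 1)" "q 1 0 = 1 / (L + 1)"
    and "0 \<le> L" "\<rho> < 1" "\<alpha> < L + 1"
  shows "\<Upsilon> q \<alpha> \<rho> 2 = L * \<rho> / (L + 1 - \<alpha>)"
proof -
  have nz: "L + 1 \<noteq> 0" "L + 1 - \<rho> \<noteq> 0" "L + 1 - \<alpha> \<noteq> 0"
    using assms by auto
  have q2: "q (2 - 1) 0 = 1 / (L + 1)"
    using q(2) by simp
  have e: "1 - 1 / (L + 1) = L / (L + 1)" "1 - 1 / (L + 1) * \<rho> = (L + 1 - \<rho>) / (L + 1)"
    "1 - 1 / (L + 1) * \<alpha> = (L + 1 - \<alpha>) / (L + 1)"
    using nz by (auto simp: field_simps)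
  have "\<Upsilon> q \<alpha> \<rho> 2 = 1 / (L + 1) * (L / (L + 1)) / ((L + 1 - \<rho>) / (L + 1)) *
      ((\<alpha> - \<rho>) / ((L + 1 - \<alpha>) / (L + 1)) * \<rho> + \<rho>\<^sup>2) + \<rho> * (L / (L + 1))"
    unfolding \<Upsilon>_def q q2 e by simp
  also have "\<dots> = L * \<rho> / (L + 1 - \<alpha>)"
    using nz by (simp add: divide_simps) algebra
  finally show ?thesis .
qed

theorem mainTheorem4:
  fixes M :: "'a measure" and N :: "nat \<Rightarrow> 'a \<Rightarrow> nat"
    and q :: "nat \<Rightarrow> nat \<Rightarrow> real" and \<Lambda> i :: nat and \<rho> :: real
  assumes "\<Lambda> \<ge> 2" and "0 \<le> \<rho>" and "\<rho> < 1"
    and "homogeneous_markov_chain M {0..\<Lambda>} q N"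
    and "AE \<omega> in M. N 0 \<omega> = 0"
    and "\<forall>a\<in>{0..\<Lambda>}. \<forall>b\<in>{0..\<Lambda>}. q a b = 1 / (real \<Lambda> + 1)"
    and "f_bar M N i \<Lambda> \<rho> * (real \<Lambda> + 1 - real \<Lambda> * \<rho>) < real \<Lambda> + 1"
  shows "(\<forall>\<alpha>\<ge>0. \<alpha> < real \<Lambda> + 1 \<longleftrightarrow> \<alpha> * q 0 0 < 1) \<and>
    (\<forall>\<alpha>. 0 \<le> \<alpha> \<and> \<alpha> < real \<Lambda> + 1 \<and> (\<forall>s\<in>{2..\<Lambda> + 1}. \<Upsilon> q \<alpha> \<rho> s < 1)
         \<longrightarrow> \<Omega> M N i \<alpha> \<rho> < 1) \<and>
    (\<exists>\<alpha>. 0 \<le> \<alpha> \<and> \<alpha> < real \<Lambda> + 1 \<and> \<Omega> M N i \<alpha> \<rho> < 1 \<and>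
         (\<exists>s\<in>{2..\<Lambda> + 1}. \<not> \<Upsilon> q \<alpha> \<rho> s < 1))"
proof -
  let ?L = "real \<Lambda>"
  let ?\<alpha> = "?L + 1 - ?L * \<rho>"
  have q: "q 0 0 = 1 / (?L + 1)" "q 1 0 = 1 / (?L + 1)"
    using assms(1,6) by auto
  have \<Upsilon>_iff: "\<Upsilon> q \<alpha> \<rho> 2 < 1 \<longleftrightarrow> \<alpha> < ?\<alpha>" if "\<alpha> < ?L + 1" for \<alpha>
  proof -
    have "\<Upsilon> q \<alpha> \<rho> 2 = ?L * \<rho> / (?L + 1 - \<alpha>)"
      by (rule \<Upsilon>_2_uniform) (use q assms(3) that in auto)
    then show ?thesis
      using that by (auto simp: divide_less_eq)
  qed
  have f_nonneg: "0 \<le> f_bar M N i \<Lambda> \<rho>"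
    unfolding f_bar_def using assms(2) by (intro mult_nonneg_nonneg infsum_nonneg) auto
  have \<Omega>_less: "\<Omega> M N i \<alpha> \<rho> < 1" if "\<alpha> \<le> ?\<alpha>" for \<alpha>
  proof -
    have "\<Omega> M N i \<alpha> \<rho> * (?L + 1) = f_bar M N i \<Lambda> \<rho> * \<alpha>"
      by (simp add: \<Omega>_def f_bar_def)
    also have "\<dots> \<le> f_bar M N i \<Lambda> \<rho> * ?\<alpha>"
      using that f_nonneg by (rule mult_left_mono)
    also have "\<dots> < ?L + 1"
      by (rule assms(7))
    finally show ?thesis
      by simp
  qed
  have "\<rho> \<noteq> 0"
  proof
    assume "\<rho> = 0"
    moreover have "\<P>(\<omega> in M. \<Delta> N i \<omega> = enat 1) = 1 / (?L + 1)"
      by (rule prob_gap_eq_1[OF assms(4,5)]) (use assms(6) in auto)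
    ultimately show False
      using assms(7) by (simp add: f_bar_0)
  qed
  then have pos: "0 < ?L * \<rho>"
    using assms(1,2) by simp
  have le: "?L * \<rho> \<le> ?L"
    using assms(2,3) by (intro mult_left_le) auto
  have "\<forall>\<alpha>\<ge>0. \<alpha> < ?L + 1 \<longleftrightarrow> \<alpha> * q 0 0 < 1"
    by (auto simp: q field_simps)
  moreover have "\<Omega> M N i \<alpha> \<rho> < 1"
    if "\<alpha> < ?L + 1" "\<forall>s\<in>{2..\<Lambda> + 1}. \<Upsilon> q \<alpha> \<rho> s < 1" for \<alpha>
    using that \<Upsilon>_iff[of \<alpha>] assms(1) by (intro \<Omega>_less) auto
  moreover have "0 \<le> ?\<alpha>" "?\<alpha> < ?L + 1" "\<Omega> M N i ?\<alpha> \<rho> < 1" "\<not> \<Upsilon> q ?\<alpha> \<rho> 2 < 1"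
    using pos le \<Upsilon>_iff[of ?\<alpha>] \<Omega>_less[of ?\<alpha>] by auto
  moreover have "2 \<in> {2..\<Lambda> + 1}"
    using assms(1) by simp
  ultimately show ?thesis
    by blast
qed

end
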